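(* Let $p>1$ be an integer, and let $A(b)$, $b\in\mathcal{B}=\{1,2,\dots\}$, be the policy class of deterministic ski-rental algorithms in which the parameter $b$ is the number of renting days. The degradation factor of algorithm $A(b)$, with respect to the baseline $A(p)$, the optimal $2$-competitive algorithm, is $$\mathrm{DF}(A(b)) = \frac12 + \max\left\{\frac{p}{2b},\frac{b}{2p}\right\}.$$
   Context: Ski-rental problem: a skier goes skiing for an unknown number of days. On each day the skier can either rent skis at a unit price or buy them at a higher integer price $p>1$ and ski for free from then on. Only deterministic algorithms are considered. The algorithm $A(b)$ has $b$ as its number of renting days: it rents up to this break-even point and then buys if skiing continues. The baseline $A(p)$ is the break-even algorithm, which has the optimal competitive ratio $2$ among deterministic algorithms. The competitive ratio $\mathrm{CR}(A)$ of an online algorithm $A$ is the worst-case ratio, over all inputs, between the cost of $A$ and the cost of the offline optimal solution. Degradation factor: for a family of algorithms $A(\theta)$ parameterized by $\theta$ and a baseline algorithm $A(\theta_0)$, the degradation factor $\mathrm{DF}(A(\theta))$ is the worst-case performance degradation of $A(\theta)$ with respect to the baseline, introduced through $\mathrm{CR}(A(\theta))\le \mathrm{DF}(A(\theta))\,\mathrm{CR}(A(\theta_0))$; for the ski-rental problem it is evaluated as the ratio $\mathrm{DF}(A(b))=\mathrm{CR}(A(b))/\mathrm{CR}(A(p))$ with $\mathrm{CR}(A(p))=2$.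
   Formalization: The skiing season may last any positive real time, with rent accruing continuously, instead of a whole number of days; with whole days the formula fails (p=3, b=1 gives DF=1, not 2) and the ratio 2 is not optimal. *)

theory Defs
  imports Complex_Main "HOL-Library.Extended_Real"
begin

text \<open>
  Time is continuous: the input is the duration \<open>x > 0\<close> of the skiing season, measured in days,
  and the rent accrues at one unit per day, while the price \<open>p\<close> and the parameter \<open>b\<close> remain
  integers.  This is the model in which the break-even algorithm is exactly \<open>2\<close>-competitive and
  optimal.  If \<open>x\<close> ranged over the integers, then for \<open>b < p\<close> the worst input for the algorithm
  buying after \<open>b\<close> renting days would be \<open>x = b + 1\<close>, with ratio \<open>(b + p) / (b + 1)\<close> instead of
  \<open>(b + p) / b\<close>, and the optimal deterministic ratio would be \<open>2 - 1 / p\<close> instead of \<open>2\<close>.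

  A deterministic online algorithm is determined by its purchase time \<open>\<tau> \<in> [0, \<infinity>]\<close>: it rents up to
  time \<open>\<tau>\<close> and buys if skiing continues beyond \<open>\<tau>\<close>; \<open>\<tau> = \<infinity>\<close> means never buying.
\<close>

definition ski_cost :: "nat \<Rightarrow> ereal \<Rightarrow> real \<Rightarrow> ereal" where
  "ski_cost p \<tau> x = min (ereal x) \<tau> + (if \<tau> < ereal x then ereal (real p) else 0)"

text \<open>The offline optimum chooses the purchase time knowing \<open>x\<close>.\<close>

definition ski_opt :: "nat \<Rightarrow> real \<Rightarrow> ereal" where
  "ski_opt p x = (INF \<tau>\<in>{0..}. ski_cost p \<tau> x)"

text \<open>Extended real values, since the ratio is unbounded for \<open>\<tau> = 0\<close> and \<open>\<tau> = \<infinity>\<close>.\<close>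

definition competitive_ratio :: "nat \<Rightarrow> ereal \<Rightarrow> ereal" where
  "competitive_ratio p \<tau> = (SUP x\<in>{0<..}. ski_cost p \<tau> x / ski_opt p x)"

definition renting_days_alg :: "nat \<Rightarrow> ereal" where
  "renting_days_alg b = ereal (real b)"

definition degradation_factor :: "nat \<Rightarrow> ereal \<Rightarrow> ereal \<Rightarrow> ereal" where
  "degradation_factor p \<tau>\<^sub>0 \<tau> = competitive_ratio p \<tau> / competitive_ratio p \<tau>\<^sub>0"

end

theory Submission
  imports Defs
begin

text \<open>
  The offline cost of a season of length \<open>x\<close> is \<open>min x p\<close>.  The worst season for the purchase time
  \<open>t > 0\<close> ends just after the purchase: letting \<open>x\<close> decrease to \<open>t\<close> gives the ratio
  \<open>(t + p) / min t p = 1 + max (p / t) (t / p)\<close>, which is a supremum but, for \<open>t < p\<close>, not attained.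
\<close>

text \<open>Buying at time 0 costs \<open>p\<close>. Choosing \<open>\<tau> = x\<close> means
  renting throughout, since a purchase needs \<open>\<tau> < x\<close> strictly. Any other choice
  either pays \<open>p\<close> on top of some rent or rents for all of \<open>x\<close>.\<close>

lemma ski_opt_eq:
  assumes "x > 0"
  shows "ski_opt p x = ereal (min x (real p))"
  unfolding ski_opt_def
proof (rule antisym)
  have "(INF \<tau>\<in>{0..}. ski_cost p \<tau> x) \<le> ski_cost p 0 x"
    by (rule INF_lower) auto
  moreover have "(INF \<tau>\<in>{0..}. ski_cost p \<tau> x) \<le> ski_cost p (ereal x) x"
    using assms by (intro INF_lower) auto
  ultimately show "(INF \<tau>\<in>{0..}. ski_cost p \<tau> x) \<le> ereal (min x (real p))"
    using assms by (simp add: ski_cost_def min_def)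
next
  show "ereal (min x (real p)) \<le> (INF \<tau>\<in>{0..}. ski_cost p \<tau> x)"
  proof (rule INF_greatest)
    fix \<tau> :: ereal
    assume "\<tau> \<in> {0..}"
    then show "ereal (min x (real p)) \<le> ski_cost p \<tau> x"
      by (cases \<tau>) (auto simp: ski_cost_def min_def)
  qed
qed

text \<open>Turns a single season into a lower bound on the supremum; used below near the purchase
  time and with explicit bad seasons.\<close>

lemma ski_cost_le_competitive_ratio:
  assumes "x > 0"
  shows "ski_cost p \<tau> x / ereal (min x (real p)) \<le> competitive_ratio p \<tau>"
  unfolding competitive_ratio_def ski_opt_eq[OF assms, symmetric]
  using assms by (intro SUP_upper) auto

lemma competitive_ratio_ereal:
  assumes "t > 0" and "p > 0"
  shows "competitive_ratio p (ereal t) = ereal ((t + real p) / min t (real p))"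
proof (rule antisym)
  show "competitive_ratio p (ereal t) \<le> ereal ((t + real p) / min t (real p))"
    unfolding competitive_ratio_def
  proof (rule SUP_least)
    fix x :: real
    assume "x \<in> {0<..}"
    then have x: "x > 0" by simp
    have "min x t + (if t < x then real p else 0) \<le> (t + real p) / min t (real p) * min x (real p)"
    proof (cases "t < x")
      case True
      \<comment> \<open>After the purchase the cost stays at \<open>t + p\<close>, while the optimum
        is at least \<open>min t p\<close>.\<close>
      have "(t + real p) * min t (real p) \<le> (t + real p) * min x (real p)"
        using True assms by (intro mult_left_mono) auto
      with True assms show ?thesis by (simp add: pos_le_divide_eq)
    next
      case False
      \<comment> \<open>No purchase happens, so the cost is \<open>x \<le> t\<close>. The cases
        distinguish whether the optimum rents or buys.\<close>
      have "x * min t (real p) \<le> (t + real p) * min x (real p)"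
      proof (cases "x \<le> real p")
        case True
        have "x * min t (real p) \<le> x * (t + real p)"
          using x assms by (intro mult_left_mono) auto
        with True show ?thesis by (simp add: mult.commute)
      next
        case False
        have "x * real p \<le> (t + real p) * real p"
          using \<open>\<not> t < x\<close> by (intro mult_right_mono) auto
        with False \<open>\<not> t < x\<close> show ?thesis by simp
      qed
      with False assms show ?thesis by (simp add: pos_le_divide_eq)
    qed
    then have "(min x t + (if t < x then real p else 0)) / min x (real p)
        \<le> (t + real p) / min t (real p)"
      using x assms by (subst pos_divide_le_eq) auto
    moreover have "ski_cost p (ereal t) x = ereal (min x t + (if t < x then real p else 0))"
      by (simp add: ski_cost_def min_def)
    ultimately show "ski_cost p (ereal t) x / ski_opt p x \<le> ereal ((t + real p) / min t (real p))"
      using x assms by (simp add: ski_opt_eq del: ereal_min)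
  qed
next
  \<comment> \<open>For \<open>x > t\<close> the ratio depends on \<open>x\<close> only through the
    continuous \<open>min x p\<close>. The limit is taken from the right because at
    \<open>x = t\<close> nothing is bought.\<close>
  have "((\<lambda>x. ereal ((t + real p) / min x (real p))) \<longlongrightarrow>
      ereal ((t + real p) / min t (real p))) (at_right t)"
    using assms by (intro tendsto_intros) auto
  moreover have "\<forall>\<^sub>F x in at_right t.
      ereal ((t + real p) / min x (real p)) \<le> competitive_ratio p (ereal t)"
    using eventually_at_right_less[of t]
  proof eventually_elim
    case (elim x)
    then show ?case
      using ski_cost_le_competitive_ratio[of x p "ereal t"] assms
      by (simp add: ski_cost_def min_absorb2 del: ereal_min split: if_splits)
  qed
  ultimately show "ereal ((t + real p) / min t (real p)) \<le> competitive_ratio p (ereal t)"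
    by (rule tendsto_upperbound) simp
qed

text \<open>Of the two reciprocal quotients, the larger one has the minimum as its
  denominator.\<close>

lemma add_divide_min:
  fixes s t :: real
  assumes "s > 0" and "t > 0"
  shows "(t + s) / min t s = 1 + max (s / t) (t / s)"
proof (cases "t \<le> s")
  case True
  then have "t / s \<le> 1" "1 \<le> s / t" using assms by auto
  then have "max (s / t) (t / s) = s / t" by linarith
  with True assms show ?thesis by (simp add: add_divide_distrib)
next
  case False
  then have "s / t \<le> 1" "1 \<le> t / s" using assms by auto
  then have "max (s / t) (t / s) = t / s" by linarith
  with False assms show ?thesis by (simp add: add_divide_distrib)
qed

text \<open>For finite positive times, \<open>min t p\<close> is at most the mean of
  \<open>t\<close> and \<open>p\<close>. The closed formula does not cover 0 and \<infinity>, so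
  each gets its own bad season.\<close>

lemma competitive_ratio_ge_2:
  assumes "\<tau> \<ge> 0" and "p > 0"
  shows "2 \<le> competitive_ratio p \<tau>"
proof (cases \<tau>)
  case (real t)
  show ?thesis
  proof (cases "t = 0")
    case True
    \<comment> \<open>Buying at once costs \<open>p\<close>, whereas renting for
      \<open>p / 2\<close> days is optimal: ratio 2.\<close>
    with real assms show ?thesis
      using ski_cost_le_competitive_ratio[of "real p / 2" p \<tau>]
      by (simp add: ski_cost_def min_def zero_ereal_def)
  next
    case False
    then have "t > 0" using real assms by simp
    moreover have "min t (real p) * 2 \<le> t + real p" by simp
    ultimately have "2 \<le> (t + real p) / min t (real p)"
      using assms by (subst pos_le_divide_eq) auto
    then have "ereal 2 \<le> competitive_ratio p (ereal t)"
      using \<open>t > 0\<close> assms by (simp only: competitive_ratio_ereal ereal_less_eq)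
    then show ?thesis using real by simp
  qed
next
  case PInf
  \<comment> \<open>Renting for \<open>2 * p\<close> days costs twice the optimal purchase at the
    start.\<close>
  with assms show ?thesis
    using ski_cost_le_competitive_ratio[of "2 * real p" p \<tau>]
    by (simp add: ski_cost_def min_def)
qed (use assms in auto)

theorem theorem2p1:
  fixes p :: nat
  assumes "p > 1"
  shows "competitive_ratio p (renting_days_alg p) = 2
    \<and> (\<forall>\<tau>\<ge>0. competitive_ratio p (renting_days_alg p) \<le> competitive_ratio p \<tau>)
    \<and> (\<forall>b\<ge>1. degradation_factor p (renting_days_alg p) (renting_days_alg b)
          = ereal (1 / 2 + max (real p / (2 * real b)) (real b / (2 * real p))))"
proof (intro conjI allI impI)
  show baseline: "competitive_ratio p (renting_days_alg p) = 2"
    using assms by (simp add: renting_days_alg_def competitive_ratio_ereal)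
  show "competitive_ratio p (renting_days_alg p) \<le> competitive_ratio p \<tau>" if "\<tau> \<ge> 0" for \<tau>
    using competitive_ratio_ge_2[OF that, of p] assms by (simp add: baseline)
  fix b :: nat
  assume "b \<ge> 1"
  then have "competitive_ratio p (renting_days_alg b)
      = ereal (1 + max (real p / real b) (real b / real p))"
    using assms by (simp add: renting_days_alg_def competitive_ratio_ereal add_divide_min)
  then have "degradation_factor p (renting_days_alg p) (renting_days_alg b)
      = ereal (1 + max (real p / real b) (real b / real p)) / ereal 2"
    by (simp add: degradation_factor_def baseline)
  also have "\<dots> = ereal ((1 + max (real p / real b) (real b / real p)) / 2)"
    by simp
  \<comment> \<open>Division by the positive baseline ratio 2 commutes with
    \<open>max\<close>.\<close>
  also have "(1 + max (real p / real b) (real b / real p)) / 2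
      = 1 / 2 + max (real p / (2 * real b)) (real b / (2 * real p))"
    by (simp add: max_def)
  finally show "degradation_factor p (renting_days_alg p) (renting_days_alg b)
      = ereal (1 / 2 + max (real p / (2 * real b)) (real b / (2 * real p)))" .
qed

end
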